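(* Let $0<a<b$ be real numbers and let $p\in\left((-\infty,0)\cup[1,\infty)\right)\setminus\{-1\}$. Then for all $x\in[a,b]$, $$(b-a)\left\{[A_p(a,b)]^p-[L_p(a,b)]^p\right\}\ge (x-a)\left\{[A_p(a,x)]^p-[L_p(a,x)]^p\right\}.$$
   Context: For positive reals $u,v$, $A_p(u,v)=\left(\frac{u^p+v^p}{2}\right)^{1/p}$ is the power mean, and for $u\ne v$, $L_p(u,v)=\left(\frac{v^{p+1}-u^{p+1}}{(p+1)(v-u)}\right)^{1/p}$ is the $p$-logarithmic mean, with the usual convention $L_p(u,u)=u$. *)

theory Defs
  imports "HOL-Analysis.Analysis"
begin

(* Both means are meant for u, v > 0.  Where the defining formula divides by zero the values
   are junk: power_mean for p = 0, and log_mean for p = 0 or p = -1 with distinct u, v. *)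

definition power_mean :: "real \<Rightarrow> real \<Rightarrow> real \<Rightarrow> real" where
  "power_mean p u v = ((u powr p + v powr p) / 2) powr (1 / p)"

definition log_mean :: "real \<Rightarrow> real \<Rightarrow> real \<Rightarrow> real" where
  "log_mean p u v =
     (if u = v then u
      else ((v powr (p + 1) - u powr (p + 1)) / ((p + 1) * (v - u))) powr (1 / p))"

end

theory Submission
  imports Defs
begin

text \<open>
  After multiplication by \<open>x - a\<close>, the difference of the \<open>p\<close>-th powers of the two means is the
  error of the trapezoidal rule for \<open>t \<mapsto> t\<^sup>p\<close> on \<open>[a, x]\<close>:
  the power mean contributes the trapezoid \<open>(x - a) (a\<^sup>p + x\<^sup>p) / 2\<close>, the logarithmic mean the
  integral \<open>(x\<^bsup>p+1\<^esup> - a\<^bsup>p+1\<^esup>) / (p + 1)\<close> (\<open>mean_gap_eq_trapezoid_error\<close>).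
  The derivative of this error in \<open>x\<close> is half of
  \<open>a\<^sup>p - (x\<^sup>p + p x\<^bsup>p-1\<^esup> (a - x))\<close>, the height at \<open>a\<close> of the curve above its tangent at \<open>x\<close>.
  For \<open>p < 0\<close> and for \<open>p \<ge> 1\<close> the function \<open>t \<mapsto> t\<^sup>p\<close> is convex, so the curve lies above its
  tangents (\<open>powr_above_tangent\<close>), and the error grows with \<open>x\<close>
  (\<open>trapezoid_error_powr_mono\<close>).
\<close>

lemma powr_above_tangent:
  fixes p x y :: real
  assumes "p \<le> 0 \<or> 1 \<le> p" "0 < x" "0 < y"
  shows "x powr p + p * x powr (p - 1) * (y - x) \<le> y powr p"
proof -
  \<comment> \<open>The condition on \<open>p\<close> is the sign condition on the coefficient of the second derivative.\<close>
  have "0 \<le> p * (p - 1)"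
    using assms(1) by (auto simp: zero_le_mult_iff)
  then have "0 \<le> p * ((p - 1) * t powr (p - 1 - 1))" for t
    by (simp flip: mult.assoc)
  then have "p * x powr (p - 1) * (y - x) \<le> y powr p - x powr p"
    using assms(2,3) DERIV_cmult[OF has_real_derivative_powr]
    by (intro f''_imp_f'[where C = "{0<..}" and f = "\<lambda>t. t powr p" and f' = "\<lambda>t. p * t powr (p - 1)"
          and f'' = "\<lambda>t. p * ((p - 1) * t powr (p - 1 - 1))"])
       (simp_all only: greaterThan_iff has_real_derivative_powr convex_real_interval)
  then show ?thesis by simp
qed

definition trapezoid_error_powr :: "real \<Rightarrow> real \<Rightarrow> real \<Rightarrow> real" where
  "trapezoid_error_powr p a x =
     (x - a) * (a powr p + x powr p) / 2 - (x powr (p + 1) - a powr (p + 1)) / (p + 1)"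

lemma trapezoid_error_powr_mono:
  fixes p a x y :: real
  assumes "p \<le> 0 \<or> 1 \<le> p" "p \<noteq> -1" "0 < a" "0 < x" "x \<le> y"
  shows "trapezoid_error_powr p a x \<le> trapezoid_error_powr p a y"
proof (rule DERIV_nonneg_imp_nondecreasing[OF \<open>x \<le> y\<close>])
  fix t assume "x \<le> t" "t \<le> y"
  then have t: "0 < t" using assms by simp
  have p: "p + 1 \<noteq> 0" using assms by linarith
  have "((\<lambda>x. trapezoid_error_powr p a x) has_real_derivative
      (1 * (a powr p + t powr p) + (p * t powr (p - 1)) * (t - a)) / 2
        - ((p + 1) * t powr (p + 1 - 1)) / (p + 1)) (at t)"
    unfolding trapezoid_error_powr_def
    by (intro DERIV_diff DERIV_cdivide)
       (auto intro!: derivative_eq_intros has_real_derivative_powr t)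
  moreover have "(1 * (a powr p + t powr p) + (p * t powr (p - 1)) * (t - a)) / 2
        - ((p + 1) * t powr (p + 1 - 1)) / (p + 1)
      = (a powr p - (t powr p + p * t powr (p - 1) * (a - t))) / 2"
    using p by (simp add: field_simps)
  moreover have "t powr p + p * t powr (p - 1) * (a - t) \<le> a powr p"
    using assms t by (intro powr_above_tangent)
  ultimately show "\<exists>d. (trapezoid_error_powr p a has_real_derivative d) (at t) \<and> 0 \<le> d"
    by (metis diff_ge_0_iff_ge divide_nonneg_pos zero_less_numeral)
qed

lemma powr_inverse_powr:
  fixes p z :: real
  assumes "p \<noteq> 0" "0 \<le> z"
  shows "(z powr (1 / p)) powr p = z"
  using assms by (simp add: powr_powr)

text \<open>Extracting the \<open>p\<close>-th root in the logarithmic mean loses no information because its base is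
  positive: numerator and \<open>p + 1\<close> change sign together.\<close>

lemma log_mean_powr:
  fixes p u v :: real
  assumes "p \<noteq> 0" "p \<noteq> -1" "0 < u" "u < v"
  shows "log_mean p u v powr p = (v powr (p + 1) - u powr (p + 1)) / ((p + 1) * (v - u))"
proof -
  have "0 \<le> (v powr (p + 1) - u powr (p + 1)) / (p + 1)"
  proof (cases "0 < p + 1")
    case True
    then show ?thesis using powr_less_mono2[of "p + 1" u v] assms by simp
  next
    case False
    then have "p + 1 < 0" using assms(2) by linarith
    then show ?thesis
      using powr_less_mono2_neg[of "p + 1" u v] assms by (simp add: divide_nonpos_neg)
  qed
  then have "0 \<le> (v powr (p + 1) - u powr (p + 1)) / (p + 1) / (v - u)"
    using assms by (intro divide_nonneg_nonneg[where y = "v - u"]) simp_all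
  then have "0 \<le> (v powr (p + 1) - u powr (p + 1)) / ((p + 1) * (v - u))"
    by simp
  then show ?thesis
    using assms(1,4) powr_inverse_powr unfolding log_mean_def by auto
qed

lemma mean_gap_eq_trapezoid_error:
  fixes p a x :: real
  assumes "p \<noteq> 0" "p \<noteq> -1" "0 < a" "a \<le> x"
  shows "(x - a) * (power_mean p a x powr p - log_mean p a x powr p) = trapezoid_error_powr p a x"
proof (cases "x = a")
  case True
  then show ?thesis by (simp add: trapezoid_error_powr_def)
next
  case False
  then have "log_mean p a x powr p = (x powr (p + 1) - a powr (p + 1)) / (p + 1) / (x - a)"
    using assms by (simp add: log_mean_powr divide_divide_eq_left del: times_divide_eq_right)
  then have "(x - a) * log_mean p a x powr p = (x powr (p + 1) - a powr (p + 1)) / (p + 1)"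
    using False by (metis mult.commute nonzero_eq_divide_eq right_minus_eq)
  moreover have "power_mean p a x powr p = (a powr p + x powr p) / 2"
    unfolding power_mean_def using assms(1) by (intro powr_inverse_powr) auto
  ultimately show ?thesis
    by (simp add: trapezoid_error_powr_def right_diff_distrib)
qed

theorem mainTheorem6:
  fixes a b p :: real
  assumes "0 < a" and "a < b"
    and "p \<in> ({..<0} \<union> {1..}) - {-1}"
  shows "\<forall>x\<in>{a..b}.
    (b - a) * ((power_mean p a b) powr p - (log_mean p a b) powr p)
      \<ge> (x - a) * ((power_mean p a x) powr p - (log_mean p a x) powr p)"
proof
  fix x assume x: "x \<in> {a..b}"
  have p: "p \<le> 0 \<or> 1 \<le> p" "p \<noteq> 0" "p \<noteq> -1" using assms(3) by auto
  have "trapezoid_error_powr p a x \<le> trapezoid_error_powr p a b"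
    using p assms(1) x by (intro trapezoid_error_powr_mono) auto
  then show "(b - a) * ((power_mean p a b) powr p - (log_mean p a b) powr p)
      \<ge> (x - a) * ((power_mean p a x) powr p - (log_mean p a x) powr p)"
    using p assms(1,2) x by (simp add: mean_gap_eq_trapezoid_error)
qed

end
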